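(* Let $G$ be a finite simple graph with $G \in ER(n,d,3)$ (for some $n,d$), and suppose $G$ has a uniform shared neighborhood structure. Then this uniform shared neighborhood structure is not isomorphic to the path $P_3$.
   Context: For a finite simple graph $G$ and a vertex $u$, $N(u)$ denotes the open neighborhood of $u$. $G \in ER(n,d,\lambda)$ means $G$ is edge-regular: $G$ has $n$ vertices, is regular of degree $d$, and every pair of adjacent vertices has exactly $\lambda$ common neighbors. $G$ has a uniform shared neighborhood structure (USNS) isomorphic to a graph $H$ if the induced subgraph $G[N(u)\cap N(v)]$ is isomorphic to $H$ for every pair of adjacent vertices $u \sim v$ of $G$. $P_m$ denotes the path graph on $m$ vertices. *)

theory Defs
  imports "Graph_Theory.Graph_Theory"
begin

text \<open>
  Finite simple graphs are the models of \<^locale>\<open>graph\<close>: finite symmetric digraphs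
  without loops and parallel arcs, an undirected edge being a pair of opposite arcs.
  In particular \<^const>\<open>out_degree\<close> is the usual degree of a vertex.
\<close>

definition nbhd :: "('a, 'b) pre_digraph \<Rightarrow> 'a \<Rightarrow> 'a set" where
  "nbhd G u = {v. u \<rightarrow>\<^bsub>G\<^esub> v}"

definition ER :: "nat \<Rightarrow> nat \<Rightarrow> nat \<Rightarrow> ('a, 'b) pre_digraph set" where
  "ER n d l = {G. graph G \<and> card (verts G) = n
     \<and> (\<forall>u \<in> verts G. out_degree G u = d)
     \<and> (\<forall>u v. u \<rightarrow>\<^bsub>G\<^esub> v \<longrightarrow> card (nbhd G u \<inter> nbhd G v) = l)}"

text \<open>
  If \<open>G\<close> has no edges, \<open>has_usns G H\<close> holds vacuously for every \<open>H\<close>, so that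
  speaking of the uniform shared neighborhood structure of \<open>G\<close> requires an edge.
\<close>

definition has_usns :: "('a, 'b) pre_digraph \<Rightarrow> ('c, 'd) pre_digraph \<Rightarrow> bool" where
  "has_usns G H \<longleftrightarrow>
     (\<forall>u v. u \<rightarrow>\<^bsub>G\<^esub> v \<longrightarrow> digraph_iso (G \<restriction> (nbhd G u \<inter> nbhd G v)) H)"

definition path_graph :: "nat \<Rightarrow> (nat, nat \<times> nat) pre_digraph" where
  "path_graph m = \<lparr> verts = {..<m},
     arcs = {(i, j). i < m \<and> j < m \<and> (j = Suc i \<or> i = Suc j)}, tail = fst, head = snd \<rparr>"

lemma graph_path_graph: "graph (path_graph m)"
proof -
  have "finite {(i, j). i < m \<and> j < m \<and> (j = Suc i \<or> i = Suc j)}"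
    by (rule finite_subset[of _ "{..<m} \<times> {..<m}"]) auto
  then show ?thesis
    by unfold_locales (auto simp: path_graph_def arc_to_ends_def symmetric_conv)
qed

end

theory Submission
  imports Defs
begin

text \<open>
  Suppose all shared neighborhoods are paths on three vertices. Fix an edge \<open>uv\<close> with shared
  neighborhood \<open>a - b - c\<close>. Within \<open>N(u)\<close>, which is cubic, \<open>v\<close> has the neighbors \<open>a, b, c\<close> and
  \<open>b\<close> has the neighbors \<open>v, a, c\<close>. Hence the third neighbor \<open>x\<close> of \<open>a\<close> besides \<open>v\<close> and \<open>b\<close>
  is adjacent to neither \<open>v\<close> nor \<open>b\<close> (note that \<open>x \<noteq> c\<close>, as \<open>a\<close> and \<open>c\<close> are not adjacent), so
  \<open>x\<close> is isolated in the shared neighborhood \<open>{v, b, x}\<close> of \<open>u\<close> and \<open>a\<close>.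
\<close>

text \<open>An isomorphism also acts on arcs; only its vertex map is needed here, since the argument
  is purely about adjacency.\<close>

lemma digraph_iso_obtain_bij:
  assumes "digraph_iso K H"
  obtains f where "bij_betw f (verts K) (verts H)"
    and "\<And>x y. x \<in> verts K \<Longrightarrow> y \<in> verts K \<Longrightarrow> f x \<rightarrow>\<^bsub>H\<^esub> f y \<longleftrightarrow> x \<rightarrow>\<^bsub>K\<^esub> y"
proof -
  from assms obtain h where h: "pre_digraph.digraph_isomorphism K h" and H: "H = app_iso h K"
    by (auto simp: digraph_iso_def)
  interpret wf_digraph K
    using h by (simp add: pre_digraph.digraph_isomorphism_def)
  show thesis
  proof
    show "bij_betw (iso_verts h) (verts K) (verts H)"
      using h by (simp add: H bij_betw_def digraph_isomorphism_inj_on_verts)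
  next
    fix x y assume xy: "x \<in> verts K" "y \<in> verts K"
    show "iso_verts h x \<rightarrow>\<^bsub>H\<^esub> iso_verts h y \<longleftrightarrow> x \<rightarrow>\<^bsub>K\<^esub> y"
    proof
      \<comment> \<open>An arc of \<open>H\<close> is the image of some arc of \<open>K\<close>;
        injectivity of the vertex map identifies the ends of that arc with \<open>x\<close> and
        \<open>y\<close>.\<close>
      assume "iso_verts h x \<rightarrow>\<^bsub>H\<^esub> iso_verts h y"
      then obtain x' y' where x'y': "x' \<rightarrow>\<^bsub>K\<^esub> y'"
        and eq: "iso_verts h x = iso_verts h x'" "iso_verts h y = iso_verts h y'"
        by (auto simp: H arcs_ends_app_iso_eq[OF h])
      from x'y' have "x' \<in> verts K" "y' \<in> verts K"
        by auto
      with eq xy x'y' h show "x \<rightarrow>\<^bsub>K\<^esub> y"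
        by simp
    next
      assume "x \<rightarrow>\<^bsub>K\<^esub> y"
      then show "iso_verts h x \<rightarrow>\<^bsub>H\<^esub> iso_verts h y"
        by (force simp: H arcs_ends_app_iso_eq[OF h])
    qed
  qed
qed

lemma dominates_path_graph_iff:
  "i \<rightarrow>\<^bsub>path_graph m\<^esub> j \<longleftrightarrow> i < m \<and> j < m \<and> (j = Suc i \<or> i = Suc j)"
  by (force simp: path_graph_def arcs_ends_def arc_to_ends_def)

lemma dominates_induce_subgraph_iff:
  "x \<rightarrow>\<^bsub>G \<restriction> S\<^esub> y \<longleftrightarrow> x \<in> S \<and> y \<in> S \<and> x \<rightarrow>\<^bsub>G\<^esub> y"
  by (auto simp: arcs_ends_def arc_to_ends_def)

text \<open>Pulling the vertices 0, 1, 2 of the path back through \<open>H\<close> names the shared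
  neighbors along the path, with \<open>b\<close> as its midpoint.\<close>

lemma usns_path3_obtain:
  assumes "has_usns G H" and "digraph_iso H (path_graph 3)" and "u \<rightarrow>\<^bsub>G\<^esub> v"
  obtains a b c where "nbhd G u \<inter> nbhd G v = {a, b, c}" and "a \<noteq> b" "b \<noteq> c" "a \<noteq> c"
    and "a \<rightarrow>\<^bsub>G\<^esub> b" "b \<rightarrow>\<^bsub>G\<^esub> a" "b \<rightarrow>\<^bsub>G\<^esub> c" "c \<rightarrow>\<^bsub>G\<^esub> b" "\<not> a \<rightarrow>\<^bsub>G\<^esub> c"
proof -
  define S where "S = nbhd G u \<inter> nbhd G v"
  from assms(1,3) have "digraph_iso (G \<restriction> S) H"
    by (simp add: has_usns_def S_def)
  then obtain f where f: "bij_betw f S (verts H)"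
    "\<And>x y. x \<in> S \<Longrightarrow> y \<in> S \<Longrightarrow> f x \<rightarrow>\<^bsub>H\<^esub> f y \<longleftrightarrow> x \<rightarrow>\<^bsub>G\<^esub> y"
    by (rule digraph_iso_obtain_bij) (auto simp: dominates_induce_subgraph_iff)
  from assms(2) obtain g where g: "bij_betw g (verts H) {..<3::nat}"
    "\<And>x y. x \<in> verts H \<Longrightarrow> y \<in> verts H \<Longrightarrow> g x \<rightarrow>\<^bsub>path_graph 3\<^esub> g y \<longleftrightarrow> x \<rightarrow>\<^bsub>H\<^esub> y"
    by (rule digraph_iso_obtain_bij) (auto simp: path_graph_def)
  \<comment> \<open>\<open>p i\<close> is the shared neighbor at position \<open>i\<close> of the
    path.\<close>
  define p where "p = inv_into S (g \<circ> f)"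
  have gf: "bij_betw (g \<circ> f) S {..<3}"
    using f(1) g(1) by (rule bij_betw_trans)
  then have p: "bij_betw p {..<3} S"
    unfolding p_def by (rule bij_betw_inv_into)
  have adj: "p i \<rightarrow>\<^bsub>G\<^esub> p j \<longleftrightarrow> j = Suc i \<or> i = Suc j" if ij: "i < 3" "j < 3" for i j
  proof -
    have S: "p i \<in> S" "p j \<in> S"
      using p ij by (auto dest: bij_betwE)
    then have V: "f (p i) \<in> verts H" "f (p j) \<in> verts H"
      using f(1) by (auto dest: bij_betwE)
    have "g (f (p i)) = i" "g (f (p j)) = j"
      using bij_betw_inv_into_right[OF gf, of i] bij_betw_inv_into_right[OF gf, of j] ij
      by (simp_all add: p_def)
    with f(2)[OF S] g(2)[OF V] ij show ?thesis
      by (simp add: dominates_path_graph_iff)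
  qed
  have "{..<3::nat} = {0, 1, 2}"
    by auto
  with p have "S = {p 0, p 1, p 2}" and "p 0 \<noteq> p 1" "p 1 \<noteq> p 2" "p 0 \<noteq> p 2"
    by (auto simp: bij_betw_def)
  then show thesis
    using adj by (intro that[of "p 0" "p 1" "p 2"]) (auto simp: S_def)
qed

theorem theorem1:
  fixes G :: "('a, 'b) pre_digraph" and H :: "('c, 'd) pre_digraph" and n d :: nat
  assumes "G \<in> ER n d 3"
    and "arcs G \<noteq> {}"
    and "graph H"
    and "has_usns G H"
  shows "\<not> digraph_iso H (path_graph 3)"
proof
  assume iso: "digraph_iso H (path_graph 3)"
  have "graph G" and card3: "\<And>u v. u \<rightarrow>\<^bsub>G\<^esub> v \<Longrightarrow> card (nbhd G u \<inter> nbhd G v) = 3"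
    using assms(1) by (auto simp: ER_def)
  then interpret graph G by simp
  have adj_sym: "y \<rightarrow>\<^bsub>G\<^esub> x" if "x \<rightarrow>\<^bsub>G\<^esub> y" for x y
    using that by (rule graph_symmetric)
  have irrefl: "\<not> x \<rightarrow>\<^bsub>G\<^esub> x" for x
    using adj_not_same by blast
  from assms(2) obtain e where "e \<in> arcs G"
    by blast
  then obtain u v where uv: "u \<rightarrow>\<^bsub>G\<^esub> v"
    using in_arcs_imp_in_arcs_ends by blast
  obtain a b c where Nuv: "nbhd G u \<inter> nbhd G v = {a, b, c}"
    and dist: "a \<noteq> b" "b \<noteq> c" "a \<noteq> c"
    and adj: "a \<rightarrow>\<^bsub>G\<^esub> b" "b \<rightarrow>\<^bsub>G\<^esub> a" "b \<rightarrow>\<^bsub>G\<^esub> c" "c \<rightarrow>\<^bsub>G\<^esub> b" "\<not> a \<rightarrow>\<^bsub>G\<^esub> c"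
    using usns_path3_obtain[OF assms(4) iso uv] by metis
  have abc: "u \<rightarrow>\<^bsub>G\<^esub> w" "v \<rightarrow>\<^bsub>G\<^esub> w" if "w \<in> {a, b, c}" for w
    using Nuv that by (auto simp: nbhd_def)
  have vabc: "v \<noteq> a" "v \<noteq> b" "v \<noteq> c"
    using abc(2) irrefl by auto
  \<comment> \<open>The vertices \<open>v\<close>, \<open>a\<close>, \<open>c\<close> are distinct
    common neighbors of \<open>u\<close> and \<open>b\<close>, and by edge-regularity there are only
    three.\<close>
  have Nub: "nbhd G u \<inter> nbhd G b = {v, a, c}"
  proof (rule sym, rule card_subset_eq)
    \<comment> \<open>An infinite set would have cardinality 0 instead of 3.\<close>
    show "finite (nbhd G u \<inter> nbhd G b)"
      using card3[of u b] abc(1)[of b] by (intro card_ge_0_finite) simp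
    show "{v, a, c} \<subseteq> nbhd G u \<inter> nbhd G b"
      using uv abc adj adj_sym by (auto simp: nbhd_def)
    show "card {v, a, c} = card (nbhd G u \<inter> nbhd G b)"
      using card3[of u b] abc(1)[of b] dist vabc by simp
  qed
  have ua: "u \<rightarrow>\<^bsub>G\<^esub> a"
    using abc by simp
  have isolated: "\<not> x \<rightarrow>\<^bsub>G\<^esub> y"
    if "x \<in> nbhd G u \<inter> nbhd G a" "x \<noteq> v" "x \<noteq> b" "y \<in> {v, b, x}" for x y
  proof
    assume "x \<rightarrow>\<^bsub>G\<^esub> y"
    \<comment> \<open>Without loops, \<open>y\<close> is \<open>v\<close> or
      \<open>b\<close>.\<close>
    with that irrefl have "x \<in> nbhd G u \<inter> nbhd G v \<or> x \<in> nbhd G u \<inter> nbhd G b"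
      by (auto simp: nbhd_def dest: adj_sym)
    \<comment> \<open>Either way \<open>x\<close> is \<open>a\<close> or \<open>c\<close>, but
      \<open>x\<close> is adjacent to \<open>a\<close>, which neither \<open>a\<close> nor
      \<open>c\<close> is.\<close>
    with that adj(5) irrefl show False
      unfolding Nuv Nub by (auto simp: nbhd_def)
  qed
  obtain a' b' c' where Nua: "nbhd G u \<inter> nbhd G a = {a', b', c'}"
    and dist': "a' \<noteq> b'" "b' \<noteq> c'" "a' \<noteq> c'"
    and adj': "a' \<rightarrow>\<^bsub>G\<^esub> b'" "b' \<rightarrow>\<^bsub>G\<^esub> a'" "b' \<rightarrow>\<^bsub>G\<^esub> c'" "c' \<rightarrow>\<^bsub>G\<^esub> b'" "\<not> a' \<rightarrow>\<^bsub>G\<^esub> c'"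
    using usns_path3_obtain[OF assms(4) iso ua] by metis
  have "v \<in> {a', b', c'}" "b \<in> {a', b', c'}"
    unfolding Nua[symmetric] using uv abc adj adj_sym by (auto simp: nbhd_def)
  \<comment> \<open>The one vertex of the path \<open>a'\<close>, \<open>b'\<close>,
    \<open>c'\<close> other than \<open>v\<close> and \<open>b\<close> is isolated by
    \<open>isolated\<close>, yet every vertex of this path has a neighbor on it.\<close>
  then show False
    using isolated[unfolded Nua] adj' dist' vabc(2) by (auto; metis)
qed

end
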